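(* There exists a multiplicative function $f:\mathbb{N}\to[-1,1]$ such that $\mathbb{D}(1,f;x)^2=2\log\log x+O(1)$ for all $x\ge 2$ and $$\limsup_{x\to\infty}\left|\frac1x\sum_{n\le x}f(n^2+1)\right|\ge\frac12 .$$
   Context: For multiplicative functions $f,g:\mathbb{N}\to\mathbb{C}$ with values in the closed unit disc, $$\mathbb{D}(f,g;x)=\left(\sum_{p\le x}\frac{1-\operatorname{Re}(f(p)\overline{g(p)})}{p}\right)^{1/2},$$ the sum being over primes $p$. Here $1$ denotes the constant function $1$. Sums over $n\le x$ run over positive integers $n$. *)

theory Defs
  imports "HOL-Analysis.Analysis" "HOL-Computational_Algebra.Primes"
begin

(* Arithmetic functions live on the positive integers: the value at 0 is unconstrained. *)
definition multiplicative_fun :: "(nat \<Rightarrow> 'a::comm_semiring_1) \<Rightarrow> bool" where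
  "multiplicative_fun f \<longleftrightarrow>
     f 1 = 1 \<and> (\<forall>m n. 0 < m \<longrightarrow> 0 < n \<longrightarrow> coprime m n \<longrightarrow> f (m * n) = f m * f n)"

(* Meaningful for functions into the closed unit disc, where every summand is nonnegative. *)
definition pretentious_dist :: "(nat \<Rightarrow> complex) \<Rightarrow> (nat \<Rightarrow> complex) \<Rightarrow> real \<Rightarrow> real" where
  "pretentious_dist f g x =
     sqrt (\<Sum>p | prime p \<and> real p \<le> x. (1 - Re (f p * cnj (g p))) / real p)"

end

theory Submission
  imports Defs "HOL-Number_Theory.Prime_Powers" "HOL-Number_Theory.Residues"
    "HOL-Real_Asymp.Real_Asymp"
begin

text \<open>
  The function is completely multiplicative with values \<open>-1\<close> and \<open>1\<close>. It is \<open>-1\<close> at almost all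
  primes, which makes the squared distance to 1 equal to twice the sum of \<open>1 / p\<close> up to a bounded
  error, and Mertens' theorem evaluates that sum.

  The values at a sparse set of primes are reserved to spoil the cancellation in the sum of
  \<open>f (n\<^sup>2 + 1)\<close> at a rapidly growing sequence of scales \<open>x\<close>. Two facts make this possible. First, for
  fixed \<open>M\<close> and \<open>x\<close> tending to infinity, at least \<open>(1 / 2 - o(1)) * x\<close> of the \<open>n \<le> x\<close> are such that
  \<open>n\<^sup>2 + 1\<close> has a prime factor \<open>p > M * x\<close> (\<open>eventually_card_large_prime_set\<close>). The reason is Chebyshev's: the product of all
  \<open>n\<^sup>2 + 1\<close> has logarithm \<open>2 * x * ln x\<close>, the primes up to \<open>M * x\<close> account for only about \<open>x * ln x\<close> of it
  by Mertens' theorem in the residue classes modulo 4 (\<open>sum_chi4_mangoldt_over_bounded\<close>), and no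
  \<open>n\<^sup>2 + 1\<close> contributes more than \<open>2 * ln x\<close>. Second, if \<open>M \<ge> 2\<close> then these primes are pairwise
  distinct, so the values of \<open>f\<close> at them can be adjusted to give all those \<open>n\<close> one common sign, the
  sign of the sum over the remaining \<open>n\<close> (\<open>adjust_signs_at_large_primes\<close>). The mean value then is at
  least \<open>1 / 2 - o(1)\<close> in absolute value.

  At most \<open>x\<close> primes beyond \<open>M * x\<close> are changed, so the reciprocals of the changed primes sum to at
  most \<open>1 / M\<close>. Letting \<open>M\<close> run through the powers of 2 along the scales keeps the total bounded
  (\<open>exists_adjusted_signs\<close>), and the distance is not disturbed.
\<close>

section \<open>The estimates of Chebyshev and Mertens\<close>

abbreviation Lambda :: "nat \<Rightarrow> real" ("\<Lambda>") where
  "\<Lambda> \<equiv> mangoldt"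

definition psi :: "nat \<Rightarrow> real" where
  "psi N = (\<Sum>d = 1..N. \<Lambda> d)"

lemma sum_divisors_swap:
  fixes F :: "nat \<Rightarrow> nat \<Rightarrow> real"
  shows "(\<Sum>n = 1..N. \<Sum>d | d dvd n. F d (n div d)) = (\<Sum>d = 1..N. \<Sum>m = 1..N div d. F d m)"
proof -
  have aux: "b \<le> N" if "b * k \<le> N" "0 < k" for b k :: nat
    using that by (cases k) auto
  have "(\<Sum>n = 1..N. \<Sum>d | d dvd n. F d (n div d)) =
        (\<Sum>(n, d)\<in>(SIGMA n:{1..N}. {d. d dvd n}). F d (n div d))"
    by (rule sum.Sigma) auto
  also have "\<dots> = (\<Sum>(d, m)\<in>(SIGMA d:{1..N}. {1..N div d}). F d m)"
    by (rule sum.reindex_bij_witness[where i = "\<lambda>(d, m). (d * m, d)" and j = "\<lambda>(n, d). (d, n div d)"])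
       (auto elim!: dvdE simp: less_eq_div_iff_mult_less_eq mult.commute Suc_le_eq
          intro: Nat.gr0I aux)
  also have "\<dots> = (\<Sum>d = 1..N. \<Sum>m = 1..N div d. F d m)"
    by (rule sum.Sigma [symmetric]) auto
  finally show ?thesis .
qed

lemma sum_ln_bounds:
  assumes "N \<ge> 1"
  shows "real N * ln N - N \<le> (\<Sum>n = 1..N. ln (real n))" "(\<Sum>n = 1..N. ln (real n)) \<le> real N * ln N"
proof -
  show "(\<Sum>n = 1..N. ln (real n)) \<le> real N * ln N"
    using assms sum_bounded_above[of "{1..N}" "\<lambda>n. ln (real n)" "ln N"] by simp
  show "real N * ln N - N \<le> (\<Sum>n = 1..N. ln (real n))"
    using assms
  proof (induction N rule: dec_induct)
    case (step N)
    have "ln (real (Suc N)) - ln (real N) \<le> 1 / real N"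
      using ln_diff_le[of "real (Suc N)" "real N"] step.hyps by simp
    hence "real N * (ln (real (Suc N)) - ln (real N)) \<le> 1"
      using step.hyps by (simp add: field_simps)
    thus ?case using step by (simp add: algebra_simps)
  qed simp
qed

text \<open>Summing \<open>ln n = (\<Sum>d | d dvd n. \<Lambda> d)\<close> over \<open>n \<le> N\<close> gives Chebyshev's identity. Since
  Stirling's formula controls the left-hand side, it is the source of all information on primes
  used below.\<close>

lemma sum_ln_conv_mangoldt:
  "(\<Sum>n = 1..N. ln (real n)) = (\<Sum>d = 1..N. \<Lambda> d * real (N div d))"
proof -
  have "(\<Sum>n = 1..N. ln (real n)) = (\<Sum>n = 1..N. \<Sum>d | d dvd n. \<Lambda> d)"
    by (intro sum.cong refl) (use mangoldt_sum[where ?'a = real] in auto)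
  also have "\<dots> = (\<Sum>d = 1..N. \<Lambda> d * real (N div d))"
    using sum_divisors_swap[of "\<lambda>d m. \<Lambda> d" N] by (simp add: mult.commute)
  finally show ?thesis .
qed

text \<open>In \<open>ln ((2 * m)!) - 2 * ln (m!)\<close> the coefficient \<open>(2 * m div d) - 2 * (m div d)\<close> of \<open>\<Lambda> d\<close>
  is never negative and equals 1 for \<open>m < d \<le> 2 * m\<close>; Stirling's formula bounds the whole
  expression by a multiple of \<open>m\<close>.\<close>

lemma psi_double: "psi (2 * m) - psi m \<le> 4 * real m"
proof (cases "m = 0")
  case False
  let ?T = "\<lambda>N. \<Sum>n = 1..N. ln (real n)"
  have "?T (2 * m) - 2 * ?T m \<le> 4 * real m"
  proof -
    have "ln (2::real) \<le> 1" using ln_le_minus_one[of "2::real"] by simp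
    hence "real m * ln 2 \<le> real m" using mult_left_mono[of "ln 2" 1 "real m"] by simp
    moreover have "?T (2 * m) \<le> 2 * (real m * ln 2) + 2 * (real m * ln m)"
      using sum_ln_bounds(2)[of "2 * m"] False by (simp add: ln_mult algebra_simps)
    ultimately show ?thesis
      using sum_ln_bounds(1)[of m] False by linarith
  qed
  moreover have "psi (2 * m) - psi m \<le> ?T (2 * m) - 2 * ?T m"
  proof -
    have "?T m = (\<Sum>d = 1..2 * m. \<Lambda> d * real (m div d))"
      unfolding sum_ln_conv_mangoldt by (rule sum.mono_neutral_left) auto
    hence "?T (2 * m) - 2 * ?T m = (\<Sum>d = 1..2 * m. \<Lambda> d * (real (2 * m div d) - 2 * real (m div d)))"
      unfolding sum_ln_conv_mangoldt[of "2 * m"]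
      by (simp add: sum_distrib_left algebra_simps flip: sum_subtractf)
    also have "\<dots> \<ge> (\<Sum>d = 1..2 * m. if d > m then \<Lambda> d else 0)"
    proof (rule sum_mono)
      fix d assume d: "d \<in> {1..2 * m}"
      have "real (2 * m div d) - 2 * real (m div d) \<ge> (if d > m then 1 else 0)"
      proof -
        have "2 * (m div d) \<le> 2 * m div d" 
          using d div_times_less_eq_dividend[of m d] by (simp add: less_eq_div_iff_mult_less_eq)
        moreover have "2 * m div d \<ge> 1" using d by (simp add: Suc_le_eq div_greater_zero_iff)
        ultimately show ?thesis by auto
      qed
      from mult_left_mono[OF this mangoldt_nonneg[of d]]
      show "(if d > m then \<Lambda> d else 0) \<le> \<Lambda> d * (real (2 * m div d) - 2 * real (m div d))"
        by (auto split: if_splits)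
    qed
    also have "(\<Sum>d = 1..2 * m. if d > m then \<Lambda> d else 0) = (\<Sum>d \<in> {m<..2 * m}. \<Lambda> d)"
      by (rule sum.mono_neutral_cong_right) auto
    also have "\<dots> = psi (2 * m) - psi m"
    proof -
      have "{1..2 * m} = {1..m} \<union> {m<..2 * m}" by auto
      hence "psi (2 * m) = (\<Sum>d\<in>{1..m} \<union> {m<..2 * m}. \<Lambda> d)" by (simp only: psi_def)
      thus ?thesis by (subst (asm) sum.union_disjoint) (auto simp: psi_def)
    qed
    finally show ?thesis by simp
  qed
  ultimately show ?thesis by linarith
qed (simp add: psi_def)

lemma psi_le: "psi N \<le> 6 * real N"
proof (induction N rule: less_induct)
  case (less N)
  show ?case
  proof (cases "N = 0")
    case False
    define m where "m = N div 2"
    have even: "psi (2 * m) \<le> 10 * real m"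
      using psi_double[of m] less[of m] False by (simp add: m_def)
    show ?thesis
    proof (cases "even N")
      case True
      hence "N = 2 * m" by (simp add: m_def)
      thus ?thesis using even by simp
    next
      case odd: False
      hence N: "N = Suc (2 * m)" by (simp add: m_def)
      have "\<Lambda> (Suc (2 * m)) \<le> ln (real (Suc (2 * m)))" by (rule mangoldt_le) simp
      also have "\<dots> \<le> 2 * real m" using ln_le_minus_one[of "real (Suc (2 * m))"] by simp
      finally show ?thesis using even by (simp add: N psi_def)
    qed
  qed (simp add: psi_def)
qed

text \<open>Replacing \<open>N div d\<close> by \<open>N / d\<close> in Chebyshev's identity costs at most \<open>psi N\<close>, which is
  linear in \<open>N\<close>, and then a division by \<open>N\<close> gives the claim.\<close>

lemma sum_mangoldt_over:
  assumes "N \<ge> 1"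
  shows "\<bar>(\<Sum>d = 1..N. \<Lambda> d / real d) - ln N\<bar> \<le> 6"
proof -
  let ?T = "\<Sum>n = 1..N. ln (real n)" and ?S = "\<Sum>d = 1..N. \<Lambda> d / real d"
  have "?T \<le> real N * ?S"
    unfolding sum_ln_conv_mangoldt sum_distrib_left
  proof (rule sum_mono)
    fix d show "\<Lambda> d * real (N div d) \<le> real N * (\<Lambda> d / real d)"
      using mult_left_mono[OF of_nat_div_le_of_nat[of N d] mangoldt_nonneg[of d]] by (simp add: mult.commute)
  qed
  moreover have "real N * ?S - psi N \<le> ?T"
    unfolding sum_ln_conv_mangoldt sum_distrib_left psi_def sum_subtractf[symmetric]
  proof (rule sum_mono)
    fix d 
    have "real N / real d - 1 \<le> real (N div d)"
      using floor_divide_of_nat_eq[of N d, where ?'a = real] by linarith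
    from mult_left_mono[OF this mangoldt_nonneg[of d]]
    show "real N * (\<Lambda> d / real d) - \<Lambda> d \<le> \<Lambda> d * real (N div d)" by (simp add: algebra_simps)
  qed
  ultimately have "real N * (ln N - 1) \<le> real N * ?S" "real N * ?S \<le> real N * (ln N + 6)"
    using sum_ln_bounds[OF assms] psi_le[of N] by (simp_all add: algebra_simps)
  hence "ln N - 1 \<le> ?S" "?S \<le> ln N + 6" using assms by simp_all
  thus ?thesis by linarith
qed

text \<open>Every proper prime power has the form \<open>e\<^sup>2\<close> or \<open>e\<^sup>2 * p\<close> where \<open>e\<close> is a power of the same
  prime \<open>p\<close>, so each \<open>e\<close> accounts for at most two of them. This one comparison serves twice: with
  \<open>h = 1\<close> it shows that proper prime powers up to \<open>K\<^sup>2\<close> have total weight \<open>O(K)\<close>, and with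
  \<open>h d = 1 / d\<close> that they are negligible in Mertens' sum.\<close>

lemma sum_mangoldt_nonprime_le:
  fixes h :: "nat \<Rightarrow> real"
  assumes mono: "\<And>m n. 1 \<le> m \<Longrightarrow> m \<le> n \<Longrightarrow> h n \<le> h m" and nonneg: "\<And>n. h n \<ge> 0"
  shows "(\<Sum>d | d \<in> {1..K\<^sup>2} \<and> \<not> prime d. \<Lambda> d * h d) \<le> 2 * (\<Sum>e = 1..K. \<Lambda> e * h (e\<^sup>2))"
proof -
  define E where "E = {e \<in> {1..K}. primepow e}"
  define B where "B = {d \<in> {1..K\<^sup>2}. primepow d \<and> \<not> prime d}"
  define g where "g d = \<Lambda> d * h d" for d
  have g_nonneg: "g d \<ge> 0" for d by (simp add: g_def mangoldt_nonneg nonneg)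
  have fin: "finite E" "finite B" by (auto simp: E_def B_def)
  let ?q = "\<lambda>e. e\<^sup>2 * aprimedivisor e"
  have "B \<subseteq> (\<lambda>e. e\<^sup>2) ` E \<union> ?q ` E"
  proof
    fix d assume d: "d \<in> B"
    then obtain p j where p: "prime p" "j > 0" "d = p ^ j"
      using primepow_decompose[of d] by (auto simp: B_def primepow_def)
    have "j \<noteq> 1" using d p by (auto simp: B_def)
    hence j: "j div 2 > 0" using p(2) by auto
    define e where "e = p ^ (j div 2)"
    have e_pp: "primepow e" using p j by (simp add: e_def)
    have ap: "aprimedivisor e = p" using p j by (simp add: e_def aprimedivisor_prime_power)
    have d_eq: "d = (if even j then e\<^sup>2 else ?q e)"
    proof (cases "even j")
      case True
      thus ?thesis by (simp add: e_def p(3) flip: power_mult)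
    next
      case False
      hence "j = j div 2 * 2 + 1" by presburger
      hence "d = p ^ (j div 2 * 2 + 1)" using p(3) by metis
      also have "\<dots> = e\<^sup>2 * p" by (simp add: e_def power_add power_mult)
      finally show ?thesis using False by (simp add: ap)
    qed
    have "e\<^sup>2 \<le> d" using p(1) ap prime_gt_0_nat[of p] by (auto simp: d_eq)
    also have "d \<le> K\<^sup>2" using d by (auto simp: B_def)
    finally have "e \<le> K" by simp
    hence "e \<in> E" using e_pp primepow_gt_0_nat[of e] by (auto simp: E_def)
    thus "d \<in> (\<lambda>e. e\<^sup>2) ` E \<union> ?q ` E" using d_eq by (auto split: if_splits)
  qed
  hence "sum g B \<le> sum g ((\<lambda>e. e\<^sup>2) ` E \<union> ?q ` E)"
    using fin g_nonneg by (intro sum_mono2) auto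
  also have "\<dots> \<le> sum g ((\<lambda>e. e\<^sup>2) ` E) + sum g (?q ` E)"
    using fin g_nonneg by (subst sum.union_inter[symmetric]) (auto intro!: sum_nonneg)
  also have "\<dots> \<le> (\<Sum>e\<in>E. g (e\<^sup>2)) + (\<Sum>e\<in>E. g (?q e))"
    using sum_image_le[of E g "\<lambda>e. e\<^sup>2"] sum_image_le[of E g ?q] fin g_nonneg
    by (intro add_mono) (auto simp: o_def)
  also have "\<dots> \<le> (\<Sum>e\<in>E. \<Lambda> e * h (e\<^sup>2)) + (\<Sum>e\<in>E. \<Lambda> e * h (e\<^sup>2))"
  proof (intro add_mono sum_mono)
    fix e assume "e \<in> E"
    then obtain p j where p: "prime p" "j > 0" "e = p ^ j"
      using primepow_decompose[of e] by (auto simp: E_def primepow_def)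
    have ap: "aprimedivisor e = p" using p by (simp add: aprimedivisor_prime_power)
    have e2: "e\<^sup>2 = p ^ (2 * j)" "?q e = p ^ Suc (2 * j)"
      using ap p(3) by (simp_all add: power_mult mult.commute power_even_eq)
    have L: "\<Lambda> e = ln p" "\<Lambda> (e\<^sup>2) = ln p" "\<Lambda> (?q e) = ln p"
      using p mangoldt_primepow'[where ?'a = real, of p j] mangoldt_primepow'[where ?'a = real, of p "2*j"]
        mangoldt_primepow'[where ?'a = real, of p "Suc (2*j)"] unfolding e2(2) unfolding e2(1) by simp_all
    show "g (e\<^sup>2) \<le> \<Lambda> e * h (e\<^sup>2)" by (simp add: g_def L)
    have "1 \<le> e\<^sup>2" "e\<^sup>2 \<le> ?q e" using p prime_gt_0_nat[of p] ap by auto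
    hence "h (?q e) \<le> h (e\<^sup>2)" by (rule mono)
    moreover have "ln (real p) \<ge> 0" using prime_gt_0_nat[OF p(1)] by simp
    ultimately show "g (?q e) \<le> \<Lambda> e * h (e\<^sup>2)" by (simp only: g_def L mult_left_mono)
  qed
  also have "\<dots> = 2 * (\<Sum>e\<in>E. \<Lambda> e * h (e\<^sup>2))" by simp
  also have "(\<Sum>e\<in>E. \<Lambda> e * h (e\<^sup>2)) = (\<Sum>e = 1..K. \<Lambda> e * h (e\<^sup>2))"
    by (rule sum.mono_neutral_left) (auto simp: E_def mangoldt_def)
  also have "sum g B = (\<Sum>d | d \<in> {1..K\<^sup>2} \<and> \<not> prime d. \<Lambda> d * h d)"
    by (rule sum.mono_neutral_cong_left) (auto simp: B_def mangoldt_def g_def)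
  finally show ?thesis .
qed

lemma sum_mangoldt_over_square_bounded:
  "\<exists>C. \<forall>N. (\<Sum>e = 1..N. \<Lambda> e / (real e)\<^sup>2) \<le> C"
proof -
  have "summable (\<lambda>n. \<Lambda> n / (real n)\<^sup>2)"
  proof (rule summable_comparison_test_ev)
    have "eventually (\<lambda>n::nat. ln (real n) / (real n)\<^sup>2 \<le> real n powr (-3/2)) at_top"
      by real_asymp
    thus "eventually (\<lambda>n. norm (\<Lambda> n / (real n)\<^sup>2) \<le> real n powr (-3/2)) at_top"
      using eventually_gt_at_top[of 0]
    proof eventually_elim
      case (elim n)
      have "\<Lambda> n / (real n)\<^sup>2 \<le> ln (real n) / (real n)\<^sup>2"
        using elim mangoldt_le[of n] by (intro divide_right_mono) auto
      thus ?case using elim by (simp add: mangoldt_nonneg)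
    qed
    show "summable (\<lambda>n. real n powr (-3/2))" by (simp add: summable_real_powr_iff)
  qed
  hence "(\<Sum>e = 1..N. \<Lambda> e / (real e)\<^sup>2) \<le> (\<Sum>n. \<Lambda> n / (real n)\<^sup>2)" for N
    by (intro sum_le_suminf) (auto simp: mangoldt_nonneg)
  thus ?thesis by blast
qed

lemma sum_mangoldt_nonprime_le_sqrt:
  "(\<Sum>d | d \<in> {1..K\<^sup>2} \<and> \<not> prime d. \<Lambda> d) \<le> 12 * real K"
  using sum_mangoldt_nonprime_le[of "\<lambda>_. 1" K] psi_le[of K] by (simp add: psi_def)

lemma sum_ln_prime_over_bounded:
  "\<exists>C. \<forall>N\<ge>1. \<bar>(\<Sum>p = 1..N. if prime p then ln p / real p else 0) - ln N\<bar> \<le> C"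
proof -
  obtain C where C: "(\<Sum>e = 1..N. \<Lambda> e / (real e)\<^sup>2) \<le> C" for N
    using sum_mangoldt_over_square_bounded by blast
  have "\<bar>(\<Sum>p = 1..N. if prime p then ln p / real p else 0) - ln N\<bar> \<le> 6 + 2 * C" if "N \<ge> 1" for N
  proof -
    let ?Q = "\<Sum>d \<in> {d\<in>{1..N}. \<not> prime d}. \<Lambda> d / real d"
    have "(\<Sum>d = 1..N. \<Lambda> d / real d) =
      (\<Sum>p = 1..N. (if prime p then ln p / real p else 0) + (if prime p then 0 else \<Lambda> p / real p))"
      by (rule sum.cong) auto
    also have "\<dots> = (\<Sum>p = 1..N. if prime p then ln p / real p else 0) + ?Q"
      unfolding sum.distrib by (subst sum.inter_filter) (auto intro!: sum.cong)
    finally have eq: "(\<Sum>d = 1..N. \<Lambda> d / real d) = \<dots>" .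
    have "?Q \<le> (\<Sum>d | d \<in> {1..N\<^sup>2} \<and> \<not> prime d. \<Lambda> d * (1 / real d))"
      using that by (intro order.trans[OF eq_refl sum_mono2])
        (auto simp: mangoldt_nonneg power2_eq_square intro: order.trans[OF _ mult_le_mono2, of _ _ 1])
    also have "\<dots> \<le> 2 * (\<Sum>e = 1..N. \<Lambda> e * (1 / real (e\<^sup>2)))"
      by (rule sum_mangoldt_nonprime_le) (auto simp: frac_le)
    also have "\<dots> \<le> 2 * C" using C[of N] by simp
    finally have "?Q \<le> 2 * C" .
    moreover have "?Q \<ge> 0" by (intro sum_nonneg) (auto simp: mangoldt_nonneg)
    ultimately show ?thesis using eq sum_mangoldt_over[OF that] by linarith
  qed
  thus ?thesis by blast
qed

text \<open>Partial summation for the increments of a bounded sequence. It is used both for the error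
  term in Mertens' theorem and for the partial sums of the character modulo 4.\<close>

lemma abel_summation_bound:
  fixes S b :: "nat \<Rightarrow> real"
  assumes S: "\<And>n. n \<ge> m \<Longrightarrow> \<bar>S n\<bar> \<le> C"
    and b: "\<And>n. n > m \<Longrightarrow> b (Suc n) \<le> b n" "\<And>n. n > m \<Longrightarrow> b n \<ge> 0"
  shows "\<bar>\<Sum>n \<in> {m<..N}. (S n - S (n - 1)) * b n\<bar> \<le> 2 * C * b (Suc m)"
proof (cases "N > m")
  case True
  have *: "\<bar>(\<Sum>n \<in> {m<..N}. (S n - S (n - 1)) * b n) - S N * b N + S m * b (Suc m)\<bar> \<le> C * (b (Suc m) - b N)"
    using Suc_leI[OF True]
  proof (induction N rule: dec_induct)
    case base
    have "{m<..Suc m} = {Suc m}" by auto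
    thus ?case by (simp add: algebra_simps)
  next
    case (step N)
    have "{m<..Suc N} = insert (Suc N) {m<..N}" using step.hyps by auto
    hence "(\<Sum>n \<in> {m<..Suc N}. (S n - S (n - 1)) * b n) - S (Suc N) * b (Suc N) + S m * b (Suc m)
      = ((\<Sum>n \<in> {m<..N}. (S n - S (n - 1)) * b n) - S N * b N + S m * b (Suc m)) + S N * (b N - b (Suc N))"
      by (simp add: algebra_simps)
    moreover have "\<bar>S N * (b N - b (Suc N))\<bar> \<le> C * (b N - b (Suc N))"
      using S[of N] b(1)[of N] step.hyps by (simp add: abs_mult mult_right_mono)
    ultimately show ?case using step.IH by (simp add: algebra_simps)
  qed
  have "\<bar>S N * b N\<bar> \<le> C * b N" "\<bar>S m * b (Suc m)\<bar> \<le> C * b (Suc m)"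
    using S[of N] S[of m] b(2)[of N] b(2)[of "Suc m"] True by (simp_all add: abs_mult mult_right_mono)
  thus ?thesis using * by (simp add: algebra_simps)
next
  case False
  have "C \<ge> 0" using S[of m] by linarith
  thus ?thesis using False b(2)[of "Suc m"] by simp
qed

text \<open>Mertens' second theorem follows from the first one, which is \<open>sum_ln_prime_over_bounded\<close>, by
  partial summation against \<open>1 / ln n\<close>. The error term \<open>S\<close> contributes a bounded amount. The main
  term is \<open>\<Sum>n. (ln n - ln (n - 1)) / ln n\<close>, and it is compared with the telescoping sum of
  \<open>ln (ln n) - ln (ln (n - 1))\<close>, each step costing at most \<open>1 / ln (n - 1) - 1 / ln n\<close>.\<close>

lemma mertens_second:
  "\<exists>C. \<forall>N\<ge>2. \<bar>(\<Sum>p = 1..N. if prime p then 1 / real p else 0) - ln (ln (real N))\<bar> \<le> C"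
proof -
  define a where "a n = (if prime n then ln n / real n else 0)" for n
  define P where "P N = (\<Sum>p = 1..N. if prime p then 1 / real p else 0)" for N :: nat
  obtain C where C: "\<bar>(\<Sum>p = 1..N. a p) - ln N\<bar> \<le> C" if "N \<ge> 1" for N
    using sum_ln_prime_over_bounded unfolding a_def by blast
  define S where "S n = (\<Sum>p = 1..n. a p) - ln n" for n
  define b where "b n = 1 / ln (real n)" for n
  define c where "c = 2 * C * b 3 + b 2 + \<bar>P 2\<bar> + \<bar>ln (ln 2)\<bar>"
  have abel: "\<bar>\<Sum>n \<in> {2<..N}. (S n - S (n - 1)) * b n\<bar> \<le> 2 * C * b (Suc 2)" for N
  proof (rule abel_summation_bound)
    show "\<bar>S n\<bar> \<le> C" if "n \<ge> 2" for n using C[of n] that by (simp add: S_def)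
    show "b (Suc n) \<le> b n" "b n \<ge> 0" if "n > 2" for n
      unfolding b_def using that by (auto intro!: divide_left_mono)
  qed
  have main: "\<bar>P N - ln (ln N) - P 2 + ln (ln 2) - (\<Sum>n \<in> {2<..N}. (S n - S (n - 1)) * b n)\<bar> \<le> b 2 - b N"
    if "N \<ge> 2" for N
    using that
  proof (induction N rule: dec_induct)
    case base
    show ?case by simp
  next
    case (step N)
    let ?l = "ln (real N)" and ?l' = "ln (real (Suc N))"
    have l: "?l > 0" "?l \<le> ?l'" using step.hyps by simp_all
    have P: "P (Suc N) = P N + a (Suc N) * b (Suc N)"
      using step.hyps by (auto simp: P_def a_def b_def)
    have S: "S (Suc N) - S N = a (Suc N) - (?l' - ?l)" by (simp add: S_def)
    have "{2<..Suc N} = insert (Suc N) {2<..N}" using step.hyps by auto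
    hence sum: "(\<Sum>n \<in> {2<..Suc N}. (S n - S (n - 1)) * b n) =
       (\<Sum>n \<in> {2<..N}. (S n - S (n - 1)) * b n) + (a (Suc N) - (?l' - ?l)) * b (Suc N)"
      by (simp add: S)
    have "?l' - ?l \<le> 1"
      using ln_diff_le[of "real (Suc N)" "real N"] step.hyps by (auto intro: order.trans)
    hence "(?l' - ?l) * (b N - b (Suc N)) \<le> b N - b (Suc N)"
      using l by (intro mult_left_le_one_le) (auto simp: b_def frac_le)
    moreover have "ln ?l' - ln ?l \<le> (?l' - ?l) * b N"
      using ln_diff_le[of ?l' ?l] l step.hyps by (simp add: b_def)
    moreover have "ln ?l - ln ?l' \<le> (?l - ?l') * b (Suc N)"
      using ln_diff_le[of ?l ?l'] l step.hyps by (simp add: b_def)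
    ultimately show ?case
      using step.IH unfolding P sum by (simp add: algebra_simps)
  qed
  have "\<bar>P N - ln (ln N)\<bar> \<le> c" if "N \<ge> 2" for N
  proof -
    have "b N \<ge> 0" using that by (simp add: b_def)
    thus ?thesis using main[OF that] abel[of N] by (simp add: c_def eval_nat_numeral)
  qed
  thus ?thesis unfolding P_def by blast
qed

section \<open>Primes in the residue classes modulo 4\<close>

definition chi4 :: "nat \<Rightarrow> real" where
  "chi4 n = (if n mod 4 = 1 then 1 else if n mod 4 = 3 then -1 else 0)"

lemma chi4_mult: "chi4 (m * n) = chi4 m * chi4 n"
proof -
  have "m mod 4 \<in> {0, 1, 2, 3}" "n mod 4 \<in> {0, 1, 2, 3}" by auto
  moreover have "(m * n) mod 4 = ((m mod 4) * (n mod 4)) mod 4" by (simp add: mod_mult_eq)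
  ultimately show ?thesis unfolding chi4_def by auto
qed

lemma abs_chi4_le: "\<bar>chi4 n\<bar> \<le> 1"
  by (simp add: chi4_def)

lemma sum_chi4: "(\<Sum>n = 1..N. chi4 n) = (if N mod 4 \<in> {1, 2} then 1 else 0)"
proof (induction N)
  case (Suc N)
  have "N mod 4 \<in> {0, 1, 2, 3}" by auto
  thus ?case using Suc by (auto simp: chi4_def mod_Suc)
qed simp

text \<open>The partial sums of \<open>chi4\<close> are 0 or 1. Shifting them by \<open>1 / 2\<close> makes them bounded by
  \<open>1 / 2\<close> in absolute value, which yields the sharp constant 1.\<close>

lemma sum_chi4_times_decreasing:
  fixes b :: "nat \<Rightarrow> real"
  assumes b: "\<And>n. n > m \<Longrightarrow> b (Suc n) \<le> b n" "\<And>n. n > m \<Longrightarrow> b n \<ge> 0"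
  shows "\<bar>\<Sum>n \<in> {m<..N}. chi4 n * b n\<bar> \<le> b (Suc m)"
proof -
  define S where "S n = (\<Sum>k = 1..n. chi4 k) - 1 / 2" for n
  have "(\<Sum>n \<in> {m<..N}. chi4 n * b n) = (\<Sum>n \<in> {m<..N}. (S n - S (n - 1)) * b n)"
  proof (rule sum.cong)
    fix n assume "n \<in> {m<..N}"
    then obtain k where "n = Suc k" by (cases n) auto
    thus "chi4 n * b n = (S n - S (n - 1)) * b n" by (simp add: S_def)
  qed simp
  also have "\<bar>\<dots>\<bar> \<le> 2 * (1 / 2) * b (Suc m)"
    by (rule abel_summation_bound) (use b in \<open>simp_all only: S_def sum_chi4, auto\<close>)
  finally show ?thesis by simp
qed

lemma sum_split_greater: 
  fixes g :: "nat \<Rightarrow> real"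
  assumes "k \<le> N" shows "(\<Sum>n = 1..N. g n) = (\<Sum>n = 1..k. g n) + (\<Sum>n \<in> {k<..N}. g n)"
proof -
  have "{1..N} = {1..k} \<union> {k<..N}" using assms by auto
  thus ?thesis by (simp only:) (rule sum.union_disjoint, auto)
qed

lemma ln_over_self_decreasing:
  assumes "n \<ge> (3::nat)" shows "ln (real (Suc n)) / real (Suc n) \<le> ln (real n) / real n"
proof -
  have "real n * (ln (real (Suc n)) - ln (real n)) \<le> 1"
    using ln_diff_le[of "real (Suc n)" "real n"] assms by (simp add: field_simps)
  moreover have "1 \<le> ln (real n)"
    using assms exp_le by (subst ln_ge_iff) (auto intro: order.trans)
  ultimately show ?thesis using assms by (simp add: field_simps)
qed

lemma sum_chi4_ln_over_bounded: "\<bar>\<Sum>n = 1..N. chi4 n * (ln n / real n)\<bar> \<le> 1"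
proof (cases "N \<ge> 2")
  case True
  have one_two: "{1..2} = {1, 2::nat}" by auto
  have "(\<Sum>n = 1..2. chi4 n * (ln n / real n)) = 0"
    unfolding one_two by (simp add: chi4_def)
  hence "(\<Sum>n = 1..N. chi4 n * (ln n / real n)) = (\<Sum>n \<in> {2<..N}. chi4 n * (ln n / real n))"
    using sum_split_greater[OF True, of "\<lambda>n. chi4 n * (ln n / real n)"] by simp
  also have "\<bar>\<dots>\<bar> \<le> ln (real (Suc 2)) / real (Suc 2)"
    by (rule sum_chi4_times_decreasing) (use ln_over_self_decreasing in auto)
  also have "\<dots> \<le> 1" using ln_le_minus_one[of "3::real"] by simp
  finally show ?thesis .
next
  case False
  hence "N = 0 \<or> N = 1" by auto
  thus ?thesis by auto
qed

lemma sum_chi4_over_ge: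
  assumes "N \<ge> 1" shows "(\<Sum>n = 1..N. chi4 n / real n) \<ge> 2 / 3"
proof (cases "N \<ge> 2")
  case True
  have one_two: "{1..2} = {1, 2::nat}" by auto
  have "(\<Sum>n = 1..2. chi4 n / real n) = 1"
    unfolding one_two by (simp add: chi4_def)
  moreover have "\<bar>\<Sum>n \<in> {2<..N}. chi4 n * (1 / real n)\<bar> \<le> 1 / real (Suc 2)"
    by (rule sum_chi4_times_decreasing) (auto simp: frac_le)
  ultimately show ?thesis
    using sum_split_greater[OF True, of "\<lambda>n. chi4 n / real n"] by simp
next
  case False
  hence "N = 1" using assms by auto
  thus ?thesis by (simp add: chi4_def)
qed

text \<open>The primes congruent to 1 and to 3 modulo 4 thus have the same weight in Mertens' sum, up to a
  bounded error. Dirichlet convolution rewrites the bounded sum of \<open>chi4 n * ln n / n\<close> as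
  \<open>\<Sum>d. chi4 d * \<Lambda> d / d * G (N div d)\<close>, where \<open>G K\<close> is the partial sum of \<open>\<Sum>m. chi4 m / m\<close>. As
  \<open>\<bar>G N - G (N div d)\<bar> \<le> d / N\<close>, replacing every \<open>G (N div d)\<close> by \<open>G N\<close> costs at most
  \<open>psi N / N = O(1)\<close>, and \<open>G N \<ge> 2 / 3\<close> can then be divided out. This lower bound is the finite
  form of the nonvanishing of \<open>L(1, chi4)\<close>.\<close>

lemma sum_chi4_mangoldt_over_bounded:
  "\<bar>\<Sum>d = 1..N. chi4 d * \<Lambda> d / real d\<bar> \<le> 11"
proof (cases "N \<ge> 1")
  case True
  define G where "G K = (\<Sum>m = 1..K. chi4 m / real m)" for K
  define c where "c d = chi4 d * \<Lambda> d / real d" for d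
  let ?U = "\<Sum>n = 1..N. chi4 n * (ln n / real n)"
  have "?U = (\<Sum>n = 1..N. \<Sum>d | d dvd n. c d * (chi4 (n div d) / real (n div d)))"
  proof (rule sum.cong)
    fix n assume n: "n \<in> {1..N}"
    have "chi4 n * (ln n / real n) = (\<Sum>d | d dvd n. chi4 n / real n * \<Lambda> d)"
      unfolding sum_distrib_left[symmetric] using n mangoldt_sum[of n, where ?'a = real] by simp
    also have "\<dots> = (\<Sum>d | d dvd n. c d * (chi4 (n div d) / real (n div d)))"
    proof (rule sum.cong)
      fix d assume "d \<in> {d. d dvd n}"
      then obtain k where "n = d * k" by auto
      thus "chi4 n / real n * \<Lambda> d = c d * (chi4 (n div d) / real (n div d))"
        using n by (simp add: c_def chi4_mult field_simps)
    qed simp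
    finally show "chi4 n * (ln n / real n) = (\<Sum>d | d dvd n. c d * (chi4 (n div d) / real (n div d)))" .
  qed simp
  also have "\<dots> = (\<Sum>d = 1..N. c d * G (N div d))"
    using sum_divisors_swap[of "\<lambda>d m. c d * (chi4 m / real m)" N] by (simp only: G_def sum_distrib_left)
  finally have U: "?U = (\<Sum>d = 1..N. c d * G (N div d))" .
  have "\<bar>(\<Sum>d = 1..N. c d * G N) - ?U\<bar> = \<bar>\<Sum>d = 1..N. c d * (G N - G (N div d))\<bar>"
    unfolding U sum_subtractf[symmetric] by (simp add: algebra_simps)
  also have "\<dots> \<le> (\<Sum>d = 1..N. \<Lambda> d / real N)"
  proof (rule order.trans[OF sum_abs sum_mono])
    fix d assume d: "d \<in> {1..N}"
    have "\<bar>\<Sum>m \<in> {N div d<..N}. chi4 m * (1 / real m)\<bar> \<le> 1 / real (Suc (N div d))"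
      by (rule sum_chi4_times_decreasing) (auto simp: frac_le)
    also have "\<dots> \<le> real d / real N"
    proof -
      have "N \<le> d * Suc (N div d)" using d dividend_less_times_div[of d N] by simp
      hence "real N \<le> real d * real (Suc (N div d))" by (metis of_nat_le_iff of_nat_mult)
      thus ?thesis using True by (simp add: field_simps)
    qed
    finally have "\<bar>G N - G (N div d)\<bar> \<le> real d / real N"
      using sum_split_greater[of "N div d" N "\<lambda>n. chi4 n / real n"] by (simp add: G_def)
    moreover have "\<bar>c d\<bar> \<le> \<Lambda> d / real d"
      using abs_chi4_le[of d] mangoldt_nonneg[of d] d
      by (auto simp: c_def abs_mult intro!: divide_right_mono mult_left_le_one_le)
    ultimately have "\<bar>c d\<bar> * \<bar>G N - G (N div d)\<bar> \<le> \<Lambda> d / real d * (real d / real N)"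
      by (intro mult_mono) (auto simp: mangoldt_nonneg)
    thus "\<bar>c d * (G N - G (N div d))\<bar> \<le> \<Lambda> d / real N" using d by (simp add: abs_mult)
  qed
  also have "\<dots> = psi N / real N" by (simp add: psi_def sum_divide_distrib)
  also have "\<dots> \<le> 6" using psi_le[of N] True by (simp add: divide_simps)
  finally have "\<bar>(\<Sum>d = 1..N. c d * G N)\<bar> \<le> 7"
    using sum_chi4_ln_over_bounded[of N] by linarith
  hence "\<bar>\<Sum>d = 1..N. c d\<bar> * \<bar>G N\<bar> \<le> 7" by (simp flip: sum_distrib_right add: abs_mult)
  moreover have "2 / 3 \<le> \<bar>G N\<bar>" using sum_chi4_over_ge[OF True] by (simp add: G_def)
  ultimately have "\<bar>\<Sum>d = 1..N. c d\<bar> * (2 / 3) \<le> 7"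
    by (meson abs_ge_zero mult_left_mono order.trans)
  thus ?thesis by (simp add: c_def)
qed simp

section \<open>Counting the roots of \<open>n\<^sup>2 + 1\<close> modulo prime powers\<close>

lemma card_residue_class_le:
  assumes "d > 0"
  shows "real (card {n \<in> {1..x}. [n = c] (mod d)}) \<le> real x / real d + 1"
proof -
  have "card {n \<in> {1..x}. [n = c] (mod d)} \<le> card {0..x div d}"
  proof (rule card_inj_on_le[where f = "\<lambda>n. n div d"])
    show "inj_on (\<lambda>n. n div d) {n \<in> {1..x}. [n = c] (mod d)}"
    proof (rule inj_onI)
      fix m n assume "m \<in> {n \<in> {1..x}. [n = c] (mod d)}" "n \<in> {n \<in> {1..x}. [n = c] (mod d)}" "m div d = n div d"
      hence "m mod d = n mod d" "m div d = n div d" by (auto simp: cong_def)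
      thus "m = n" by (metis div_mult_mod_eq)
    qed
  qed (auto simp: div_le_mono)
  hence "real (card {n \<in> {1..x}. [n = c] (mod d)}) \<le> real (x div d) + 1" by simp
  also have "\<dots> \<le> real x / real d + 1" by (simp add: of_nat_div_le_of_nat)
  finally show ?thesis .
qed

lemma minus_one_not_square:
  fixes p n :: nat
  assumes p: "prime p" "p mod 4 = 3"
  shows "\<not> p dvd n\<^sup>2 + 1"
proof
  assume dvd: "p dvd n\<^sup>2 + 1"
  have "\<not> p dvd n"
  proof
    assume "p dvd n"
    hence "p dvd n\<^sup>2" by (simp add: power2_eq_square)
    hence "p dvd 1" using dvd by (metis dvd_add_right_iff)
    thus False using p by simp
  qed
  hence "[n ^ (p - 1) = 1] (mod p)" using fermat_theorem p(1) by blast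
  hence fermat: "[int n ^ (p - 1) = 1] (mod int p)" by (metis cong_int_iff of_nat_1 of_nat_power)
  have "int p dvd (int n)\<^sup>2 - (-1)"
    using dvd by (simp flip: of_nat_power of_nat_add of_nat_Suc add: add.commute)
  hence "[(int n)\<^sup>2 = -1] (mod int p)" by (simp add: cong_iff_dvd_diff)
  hence "[((int n)\<^sup>2) ^ ((p - 1) div 2) = (-1) ^ ((p - 1) div 2)] (mod int p)" by (rule cong_pow)
  moreover have "2 * ((p - 1) div 2) = p - 1" "odd ((p - 1) div 2)" using p(2) by presburger+
  ultimately have "[int n ^ (p - 1) = -1] (mod int p)" by (simp flip: power_mult)
  hence "[1 = - 1] (mod int p)" using fermat by (metis cong_sym cong_trans)
  hence "int p dvd 2" by (simp add: cong_iff_dvd_diff)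
  hence "p \<le> 2" using zdvd_imp_le by fastforce
  thus False using p prime_ge_2_nat[of p] by (cases "p = 2") auto
qed

text \<open>The number \<open>p ^ j\<close> divides \<open>n\<^sup>2 - m\<^sup>2 = (n - m) * (n + m)\<close>, and \<open>p\<close> cannot divide both factors,
  for then it would divide \<open>n\<close> and hence 1. The residue \<open>(p ^ j - 1) * m\<close> is \<open>- m\<close>, written
  with natural numbers.\<close>

lemma roots_cong_or_opposite:
  fixes p j m n :: nat
  assumes p: "prime p" "odd p" and m: "p ^ j dvd m\<^sup>2 + 1" and n: "p ^ j dvd n\<^sup>2 + 1" and j: "j > 0"
  shows "[n = m] (mod p ^ j) \<or> [n = (p ^ j - 1) * m] (mod p ^ j)"
proof -
  let ?d = "int p ^ j"
  have dvd: "?d dvd (int m)\<^sup>2 + 1" "?d dvd (int n)\<^sup>2 + 1"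
    using m n by (simp_all flip: of_nat_power of_nat_add of_nat_Suc add: add.commute)
  have pp: "prime (int p)" using p by simp
  have "\<not> (int p dvd int n - int m \<and> int p dvd int n + int m)"
  proof
    assume "int p dvd int n - int m \<and> int p dvd int n + int m"
    hence "int p dvd (int n - int m) + (int n + int m)" by (blast intro: dvd_add)
    hence "int p dvd 2 * int n" by simp
    moreover have "\<not> p dvd 2" using p primes_dvd_imp_eq[OF p(1) two_is_prime_nat] by auto
    hence "\<not> int p dvd 2" using int_dvd_int_iff[of p 2] by simp
    ultimately have "int p dvd int n" using pp by (simp add: prime_dvd_mult_iff)
    hence "int p dvd (int n)\<^sup>2" by (simp add: power2_eq_square)
    moreover have "int p dvd (int n)\<^sup>2 + 1" using dvd(2) j by (metis dvd_power dvd_trans)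
    ultimately have "int p dvd 1" by (metis dvd_add_right_iff)
    thus False using pp by simp
  qed
  hence cop: "coprime ?d (int n - int m) \<or> coprime ?d (int n + int m)"
    using pp by (metis coprime_power_left_iff prime_imp_coprime)
  have "?d dvd ((int n)\<^sup>2 + 1) - ((int m)\<^sup>2 + 1)" using dvd by (rule dvd_diff[rotated])
  also have "((int n)\<^sup>2 + 1) - ((int m)\<^sup>2 + 1) = (int n - int m) * (int n + int m)"
    by (simp add: algebra_simps power2_eq_square)
  finally have "?d dvd int n - int m \<or> ?d dvd int n + int m"
    using cop by (metis coprime_dvd_mult_left_iff coprime_dvd_mult_right_iff)
  thus ?thesis
  proof
    assume "?d dvd int n - int m"
    hence "[int n = int m] (mod int (p ^ j))" by (simp add: cong_iff_dvd_diff)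
    thus ?thesis unfolding cong_int_iff by blast
  next
    assume "?d dvd int n + int m"
    hence "p ^ j dvd n + m" by (metis int_dvd_int_iff of_nat_add of_nat_power)
    hence "[n + m = 0] (mod p ^ j)" by (simp add: cong_0_iff)
    moreover have "p ^ j > 0" using prime_gt_0_nat[OF p(1)] by simp
    moreover have "(p ^ j - 1) * m + m = p ^ j * m" using calculation(2)
      by (metis Suc_diff_1 add.commute mult_Suc)
    hence "[(p ^ j - 1) * m + m = 0] (mod p ^ j)" by (simp add: cong_0_iff)
    ultimately have "[n + m = (p ^ j - 1) * m + m] (mod p ^ j)" by (metis cong_sym cong_trans)
    thus ?thesis by (simp add: cong_add_rcancel_nat)
  qed
qed

text \<open>The factor \<open>1 + chi4 d\<close> is an upper bound for the number of roots of \<open>n\<^sup>2 + 1\<close> modulo the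
  prime power \<open>d\<close>: there are at most two roots if \<open>p\<close> is 1 modulo 4, none if \<open>p\<close> is 3 modulo 4
  (although \<open>chi4 d = 1\<close> for even powers), one modulo 2 and none modulo 4.\<close>

lemma card_roots_le:
  assumes "primepow d"
  shows "real (card {n \<in> {1..x}. d dvd n\<^sup>2 + 1}) \<le> (1 + chi4 d) * (real x / real d + 1)"
proof -
  let ?R = "{n \<in> {1..x}. d dvd n\<^sup>2 + 1}"
  obtain p j where p: "prime p" "j > 0" "d = p ^ j"
    using assms by (auto simp: primepow_def)
  have d: "d > 0" using p prime_gt_0_nat by simp
  have pd: "p dvd d" using p by simp
  have nonneg: "(1 + chi4 d) * (real x / real d + 1) \<ge> 0"
    using abs_chi4_le[of d] by (intro mult_nonneg_nonneg) auto
  have "even p \<or> p mod 4 = 1 \<or> p mod 4 = 3" by presburger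
  then consider "even p" | "p mod 4 = 1" | "p mod 4 = 3" by blast
  thus ?thesis
  proof cases
    case 1
    hence p2: "p = 2" using p(1) primes_dvd_imp_eq two_is_prime_nat by blast
    have chi: "chi4 d \<ge> 0" 
    proof -
      have "even d" using p p2 by simp
      hence "d mod 4 \<noteq> 3" by presburger
      thus ?thesis by (simp add: chi4_def)
    qed
    have "?R \<subseteq> {n \<in> {1..x}. [n = 1] (mod d)}"
    proof
      fix n assume n: "n \<in> ?R"
      have "p dvd n\<^sup>2 + 1" using n by (auto intro: dvd_trans[OF pd])
      hence odd: "odd n" by (simp add: p2)
      have "\<not> 4 dvd n\<^sup>2 + 1"
      proof -
        have "n mod 4 = 1 \<or> n mod 4 = 3" using odd by presburger
        hence "(n * n) mod 4 = 1" using mod_mult_eq[of n 4 n] by auto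
        hence "\<not> 4 dvd n * n + 1" by presburger
        thus ?thesis by (simp add: power2_eq_square)
      qed
      have "j = 1"
      proof (rule ccontr)
        assume "j \<noteq> 1"
        hence "2\<^sup>2 dvd d" unfolding p(3) p2 using p(2) by (intro le_imp_power_dvd) auto
        hence "4 dvd n\<^sup>2 + 1" using n by (auto intro: dvd_trans)
        thus False using \<open>\<not> 4 dvd n\<^sup>2 + 1\<close> by contradiction
      qed
      thus "n \<in> {n \<in> {1..x}. [n = 1] (mod d)}" using n odd p p2 by (auto simp: cong_def odd_iff_mod_2_eq_one)
    qed
    hence "card ?R \<le> card {n \<in> {1..x}. [n = 1] (mod d)}" by (intro card_mono) auto
    hence "real (card ?R) \<le> 1 * (real x / real d + 1)" using card_residue_class_le[OF d, of x 1] by simp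
    also have "\<dots> \<le> (1 + chi4 d) * (real x / real d + 1)" using chi by (intro mult_right_mono) auto
    finally show ?thesis .
  next
    case 2
    have chi: "chi4 d = 1" unfolding p(3) by (induction j) (use 2 in \<open>auto simp: chi4_mult, simp_all add: chi4_def\<close>)
    show ?thesis
    proof (cases "?R = {}")
      case True
      show ?thesis using nonneg by (simp only: True) simp
    next
      case False
      then obtain m where m: "m \<in> ?R" by blast
      have "odd p" using 2 by presburger
      hence "?R \<subseteq> {n \<in> {1..x}. [n = m] (mod d)} \<union> {n \<in> {1..x}. [n = (d - 1) * m] (mod d)}"
        using roots_cong_or_opposite[of p j m] m p by blast
      hence "card ?R \<le> card ({n \<in> {1..x}. [n = m] (mod d)} \<union> {n \<in> {1..x}. [n = (d - 1) * m] (mod d)})"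
        by (intro card_mono) auto
      also have "\<dots> \<le> card {n \<in> {1..x}. [n = m] (mod d)} + card {n \<in> {1..x}. [n = (d - 1) * m] (mod d)}"
        by (rule card_Un_le)
      finally show ?thesis
        using card_residue_class_le[OF d, of x m] card_residue_class_le[OF d, of x "(d - 1) * m"] chi by simp
    qed
  next
    case 3
    have "?R = {}" using minus_one_not_square[OF p(1) 3] dvd_trans[OF pd] by blast
    thus ?thesis using nonneg by (simp only:) simp
  qed
qed

section \<open>Large prime factors of \<open>n\<^sup>2 + 1\<close>\<close>

definition large_prime_set :: "nat \<Rightarrow> nat \<Rightarrow> nat set" where
  "large_prime_set y x = {n \<in> {1..x}. \<exists>p. prime p \<and> p > y \<and> p dvd n\<^sup>2 + 1}"

text \<open>The product of \<open>n\<^sup>2 + 1\<close> over \<open>n \<le> x\<close> has logarithm about \<open>2 * x * ln x\<close>. Write it as a sum of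
  \<open>\<Lambda> d\<close> over the divisors \<open>d\<close> of the \<open>n\<^sup>2 + 1\<close>, with \<open>y = M * x\<close>. The divisors \<open>d \<le> y\<close> contribute
  \<open>x * ln x + O(y)\<close>: the root count \<open>(1 + chi4 d) * (x / d + 1)\<close> has average 1 in place of 2 because
  the sum of \<open>chi4 d * \<Lambda> d / d\<close> is bounded. Proper prime powers \<open>d > y\<close> contribute \<open>O(x)\<close>. Hence
  primes \<open>p > y\<close> contribute at least \<open>x * ln x - O(M * x)\<close>, while a single \<open>n\<close> contributes at most
  \<open>ln (x\<^sup>2 + 1)\<close>, about \<open>2 * ln x\<close>. Hence asymptotically at least half of all \<open>n \<le> x\<close> have such a prime.\<close>

lemma card_large_prime_set_ge:
  assumes x: "x \<ge> 1" and M: "M \<ge> 1"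
  shows "real x * (ln x - 128 * real M) \<le> card (large_prime_set (M * x) x) * ln (real x ^ 2 + 1)"
proof -
  define y where "y = M * x"
  define A where "A = large_prime_set y x"
  have xy: "x \<le> y" using M x by (simp add: y_def)
  define K where "K = (x + 1)\<^sup>2"
  define R where "R d = {n \<in> {1..x}. d dvd n\<^sup>2 + 1}" for d
  have R: "real (card (R d)) * \<Lambda> d \<le> (1 + chi4 d) * (real x / real d + 1) * \<Lambda> d" for d
  proof (cases "primepow d")
    case True
    thus ?thesis using card_roots_le[of d x] unfolding R_def by (intro mult_right_mono) (auto simp: mangoldt_nonneg)
  qed (simp add: mangoldt_def)
  have finD: "finite {d. d dvd n\<^sup>2 + 1}" for n :: nat by (rule finite_divisors_nat) simp
  have dvd_le: "d \<in> {1..K}" if "d dvd n\<^sup>2 + 1" "n \<in> {1..x}" for d n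
  proof -
    have "d \<le> n\<^sup>2 + 1" using that by (intro dvd_imp_le) auto
    also have "n\<^sup>2 \<le> x\<^sup>2" using that by (intro power_mono) auto
    finally have "d \<le> K" by (simp add: K_def power2_eq_square)
    moreover have "d > 0" using that by (intro Nat.gr0I) auto
    ultimately show ?thesis by auto
  qed
  have swap: "(\<Sum>n = 1..x. \<Sum>d | d dvd n\<^sup>2 + 1 \<and> P d. \<Lambda> d) = (\<Sum>d | d \<in> {1..K} \<and> P d. card (R d) * \<Lambda> d)"
    for P
  proof -
    have "(\<Sum>n = 1..x. \<Sum>d | d dvd n\<^sup>2 + 1 \<and> P d. \<Lambda> d) = (\<Sum>n = 1..x. \<Sum>d | d \<in> {d\<in>{1..K}. P d} \<and> d dvd n\<^sup>2 + 1. \<Lambda> d)"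
      using dvd_le by (intro sum.cong) auto
    also have "\<dots> = (\<Sum>d | d \<in> {1..K} \<and> P d. \<Sum>n | n \<in> {1..x} \<and> d dvd n\<^sup>2 + 1. \<Lambda> d)"
      by (rule sum.swap_restrict) auto
    finally show ?thesis by (simp add: R_def)
  qed
  have "2 * (real x * ln x - real x) \<le> 2 * (\<Sum>n = 1..x. ln (real n))"
    using sum_ln_bounds(1)[OF x] by simp
  also have "\<dots> \<le> (\<Sum>n = 1..x. ln (real (n\<^sup>2 + 1)))"
    unfolding sum_distrib_left
  proof (rule sum_mono)
    fix n assume n: "n \<in> {1..x}"
    have "2 * ln (real n) = ln (real n ^ 2)" using n by (simp add: ln_realpow)
    also have "\<dots> \<le> ln (real (n\<^sup>2 + 1))" using n by (subst ln_le_cancel_iff) (auto intro: add_pos_pos)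
    finally show "2 * ln (real n) \<le> ln (real (n\<^sup>2 + 1))" .
  qed
  also have "\<dots> = (\<Sum>n = 1..x. (\<Sum>d | d dvd n\<^sup>2 + 1 \<and> d \<le> y. \<Lambda> d) + (\<Sum>d | d dvd n\<^sup>2 + 1 \<and> (y < d \<and> \<not> prime d). \<Lambda> d)
      + (\<Sum>d | d dvd n\<^sup>2 + 1 \<and> (y < d \<and> prime d). \<Lambda> d))"
  proof (rule sum.cong)
    fix n :: nat
    let ?D = "{d. d dvd n\<^sup>2 + 1}"
    let ?D1 = "{d. d dvd n\<^sup>2 + 1 \<and> d \<le> y}"
    let ?D2 = "{d. d dvd n\<^sup>2 + 1 \<and> (y < d \<and> \<not> prime d)}"
    let ?D3 = "{d. d dvd n\<^sup>2 + 1 \<and> (y < d \<and> prime d)}"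
    have fin: "finite ?D1" "finite ?D2" "finite ?D3" by (rule finite_subset[OF _ finD[of n]]; auto)+
    have "ln (real (n\<^sup>2 + 1)) = sum \<Lambda> ?D"
      using mangoldt_sum[of "n\<^sup>2 + 1", where ?'a = real] by simp
    also have "?D = (?D1 \<union> ?D2) \<union> ?D3" by auto
    also have "sum \<Lambda> ((?D1 \<union> ?D2) \<union> ?D3) = sum \<Lambda> (?D1 \<union> ?D2) + sum \<Lambda> ?D3"
      using fin by (intro sum.union_disjoint) auto
    also have "sum \<Lambda> (?D1 \<union> ?D2) = sum \<Lambda> ?D1 + sum \<Lambda> ?D2"
      using fin by (intro sum.union_disjoint) auto
    finally show "ln (real (n\<^sup>2 + 1)) = sum \<Lambda> ?D1 + sum \<Lambda> ?D2 + sum \<Lambda> ?D3" .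
  qed simp
  also have "\<dots> = (\<Sum>n = 1..x. \<Sum>d | d dvd n\<^sup>2 + 1 \<and> d \<le> y. \<Lambda> d)
      + (\<Sum>n = 1..x. \<Sum>d | d dvd n\<^sup>2 + 1 \<and> (y < d \<and> \<not> prime d). \<Lambda> d)
      + (\<Sum>n = 1..x. \<Sum>d | d dvd n\<^sup>2 + 1 \<and> (y < d \<and> prime d). \<Lambda> d)"
    unfolding sum.distrib ..
  also have "\<dots> \<le> (real x * (ln y + 17) + 12 * real y) + 96 * real x + card A * ln (real x ^ 2 + 1)"
  proof (intro add_mono)
    have "(\<Sum>n = 1..x. \<Sum>d | d dvd n\<^sup>2 + 1 \<and> d \<le> y. \<Lambda> d) = (\<Sum>d | d \<in> {1..K} \<and> d \<le> y. card (R d) * \<Lambda> d)"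
      by (rule swap)
    also have "\<dots> \<le> (\<Sum>d = 1..y. card (R d) * \<Lambda> d)"
      by (rule sum_mono2) (auto simp: mangoldt_nonneg)
    also have "\<dots> \<le> (\<Sum>d = 1..y. real x * (\<Lambda> d / real d) + real x * (chi4 d * \<Lambda> d / real d) + 2 * \<Lambda> d)"
    proof (rule sum_mono)
      fix d
      have "(1 + chi4 d) * \<Lambda> d \<le> 2 * \<Lambda> d"
        using abs_chi4_le[of d] by (intro mult_right_mono) (auto simp: mangoldt_nonneg)
      moreover have "(1 + chi4 d) * (real x / real d + 1) * \<Lambda> d =
        real x * (\<Lambda> d / real d) + real x * (chi4 d * \<Lambda> d / real d) + (1 + chi4 d) * \<Lambda> d"
        by (simp add: algebra_simps add_divide_distrib)
      ultimately show "card (R d) * \<Lambda> d \<le> real x * (\<Lambda> d / real d) + real x * (chi4 d * \<Lambda> d / real d) + 2 * \<Lambda> d"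
        using R[of d] by linarith
    qed
    also have "\<dots> = real x * (\<Sum>d = 1..y. \<Lambda> d / real d) + real x * (\<Sum>d = 1..y. chi4 d * \<Lambda> d / real d) + 2 * psi y"
      by (simp add: sum.distrib sum_distrib_left psi_def)
    also have "\<dots> \<le> real x * (ln y + 6) + real x * 11 + 2 * (6 * real y)"
      using sum_mangoldt_over[of y] sum_chi4_mangoldt_over_bounded[of y] psi_le[of y] x xy
      by (intro add_mono mult_left_mono) auto
    finally show "(\<Sum>n = 1..x. \<Sum>d | d dvd n\<^sup>2 + 1 \<and> d \<le> y. \<Lambda> d) \<le> real x * (ln y + 17) + 12 * real y"
      by (simp add: algebra_simps)
  next
    have "(\<Sum>n = 1..x. \<Sum>d | d dvd n\<^sup>2 + 1 \<and> (y < d \<and> \<not> prime d). \<Lambda> d)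
       = (\<Sum>d | d \<in> {1..K} \<and> (y < d \<and> \<not> prime d). card (R d) * \<Lambda> d)"
      by (rule swap)
    also have "\<dots> \<le> (\<Sum>d | d \<in> {1..K} \<and> (y < d \<and> \<not> prime d). 4 * \<Lambda> d)"
    proof (rule sum_mono)
      fix d assume "d \<in> {d. d \<in> {1..K} \<and> (y < d \<and> \<not> prime d)}"
      hence "real x / real d \<le> 1" using xy by simp
      hence "(1 + chi4 d) * (real x / real d + 1) \<le> 2 * 2"
        using abs_chi4_le[of d] by (intro mult_mono) auto
      hence "(1 + chi4 d) * (real x / real d + 1) * \<Lambda> d \<le> 4 * \<Lambda> d"
        by (intro mult_right_mono) (auto simp: mangoldt_nonneg)
      thus "card (R d) * \<Lambda> d \<le> 4 * \<Lambda> d" using R[of d] by linarith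
    qed
    also have "\<dots> \<le> (\<Sum>d | d \<in> {1..K} \<and> \<not> prime d. 4 * \<Lambda> d)"
      by (rule sum_mono2) (auto simp: mangoldt_nonneg)
    also have "\<dots> = 4 * (\<Sum>d | d \<in> {1..K} \<and> \<not> prime d. \<Lambda> d)" by (simp add: sum_distrib_left)
    also have "\<dots> \<le> 4 * (12 * real (x + 1))"
      using sum_mangoldt_nonprime_le_sqrt[of "x + 1"] unfolding K_def by linarith
    also have "\<dots> \<le> 96 * real x" using x by simp
    finally show "(\<Sum>n = 1..x. \<Sum>d | d dvd n\<^sup>2 + 1 \<and> (y < d \<and> \<not> prime d). \<Lambda> d) \<le> 96 * real x" .
  next
    have "(\<Sum>n = 1..x. \<Sum>d | d dvd n\<^sup>2 + 1 \<and> (y < d \<and> prime d). \<Lambda> d) \<le> (\<Sum>n = 1..x. if n \<in> A then ln (real x ^ 2 + 1) else 0)"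
    proof (rule sum_mono)
      fix n assume n: "n \<in> {1..x}"
      show "(\<Sum>d | d dvd n\<^sup>2 + 1 \<and> (y < d \<and> prime d). \<Lambda> d) \<le> (if n \<in> A then ln (real x ^ 2 + 1) else 0)"
      proof (cases "n \<in> A")
        case True
        have "(\<Sum>d | d dvd n\<^sup>2 + 1 \<and> (y < d \<and> prime d). \<Lambda> d) \<le> (\<Sum>d | d dvd n\<^sup>2 + 1. \<Lambda> d)"
          by (rule sum_mono2) (use finD[of n] in \<open>auto simp: mangoldt_nonneg\<close>)
        also have "\<dots> = ln (real (n\<^sup>2 + 1))"
          using mangoldt_sum[of "n\<^sup>2 + 1", where ?'a = real] by simp
        also have "\<dots> \<le> ln (real x ^ 2 + 1)"
          using n by (subst ln_le_cancel_iff) (auto intro: add_pos_pos add_nonneg_pos power_mono)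
        finally show ?thesis using True by simp
      next
        case False
        hence "{d. d dvd n\<^sup>2 + 1 \<and> (y < d \<and> prime d)} = {}" using n by (auto simp: A_def large_prime_set_def)
        thus ?thesis using False by (simp only:) simp
      qed
    qed
    also have "\<dots> = (\<Sum>n \<in> A. ln (real x ^ 2 + 1))"
      by (rule sum.mono_neutral_cong_right) (auto simp: A_def large_prime_set_def)
    finally show "(\<Sum>n = 1..x. \<Sum>d | d dvd n\<^sup>2 + 1 \<and> (y < d \<and> prime d). \<Lambda> d) \<le> card A * ln (real x ^ 2 + 1)"
      by simp
  qed
  finally have *: "2 * (real x * ln x - real x) \<le> \<dots>" .
  have "ln (real y) = ln (real M) + ln (real x)" using M x by (simp add: y_def ln_mult)
  moreover have "ln (real M) \<le> real M" using ln_le_minus_one[of "real M"] M by simp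
  ultimately have "real x * ln (real y) \<le> real x * (real M + ln (real x))" by (intro mult_left_mono) auto
  moreover have "real x * 1 \<le> real x * real M" using M by (intro mult_left_mono) auto
  moreover have "real y = real x * real M" by (simp add: y_def)
  ultimately show ?thesis using * by (simp add: algebra_simps A_def flip: y_def)
qed

lemma eventually_card_large_prime_set:
  assumes "M \<ge> 1" "\<epsilon> > 0"
  shows "eventually (\<lambda>x. real (card (large_prime_set (M * x) x)) \<ge> (1 / 2 - \<epsilon>) * real x) at_top"
proof -
  define c where "c = 128 * real M"
  have "((\<lambda>x::nat. (ln (real x) - c) / ln (real x ^ 2 + 1)) \<longlongrightarrow> 1 / 2) at_top"
    by real_asymp
  hence "eventually (\<lambda>x::nat. (ln (real x) - c) / ln (real x ^ 2 + 1) > 1 / 2 - \<epsilon>) at_top"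
    by (rule order_tendstoD) (use assms in auto)
  thus ?thesis using eventually_ge_at_top[of 1]
  proof eventually_elim
    case (elim x)
    let ?l = "ln (real x ^ 2 + 1)"
    have "real x ^ 2 > 0" using elim by (intro zero_less_power) simp
    hence l: "?l > 0" by (intro ln_gt_zero) simp
    have "(1 / 2 - \<epsilon>) * real x * ?l \<le> (ln (real x) - c) / ?l * real x * ?l"
      using elim l by (intro mult_right_mono) auto
    also have "\<dots> = real x * (ln (real x) - c)" using l by simp
    also have "\<dots> \<le> card (large_prime_set (M * x) x) * ?l"
      using card_large_prime_set_ge[OF elim(2) assms(1)] by (simp add: c_def)
    finally show ?case using l by simp
  qed
qed

section \<open>The construction\<close>

definition cm_extension :: "(nat \<Rightarrow> real) \<Rightarrow> nat \<Rightarrow> real" where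
  "cm_extension g n = prod_mset (image_mset g (prime_factorization n))"

lemma cm_extension_mult:
  "m > 0 \<Longrightarrow> n > 0 \<Longrightarrow> cm_extension g (m * n) = cm_extension g m * cm_extension g n"
  by (simp add: cm_extension_def prime_factorization_mult)

lemma cm_extension_prime: "prime p \<Longrightarrow> cm_extension g p = g p"
  by (simp add: cm_extension_def prime_factorization_prime)

lemma cm_extension_cong:
  "(\<And>p. prime p \<Longrightarrow> p dvd n \<Longrightarrow> g p = h p) \<Longrightarrow> cm_extension g n = cm_extension h n"
  unfolding cm_extension_def
  by (intro arg_cong[where f = prod_mset] image_mset_cong) (auto dest: in_prime_factors_imp_prime in_prime_factors_imp_dvd)

lemma cm_extension_sign:
  assumes "\<And>p. g p \<in> {-1, 1}"
  shows "cm_extension g n \<in> {-1, 1}"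
proof -
  have "prod_mset (image_mset g N) \<in> {-1, 1}" for N
    by (induction N) (use assms in \<open>auto, blast+\<close>)
  thus ?thesis by (simp add: cm_extension_def)
qed

text \<open>For \<open>n \<le> x\<close> the number \<open>n\<^sup>2 + 1\<close> has at most one prime factor \<open>q n > y\<close>, and different \<open>n\<close>
  have different \<open>q n\<close>, because a common one would divide \<open>n - m\<close> or \<open>n + m\<close>, both at most \<open>y\<close>. So the
  values at the primes \<open>q n\<close> can be prescribed independently of one another. They are chosen to give
  all these \<open>n\<close> the same value \<open>\<sigma>\<close>, and \<open>\<sigma>\<close> is the sign of the sum \<open>S\<close> over the remaining \<open>n\<close>,
  which involve no changed prime: nothing cancels.\<close>

lemma adjust_signs_at_large_primes:
  assumes y: "2 * x \<le> y" and g: "\<And>p. g p \<in> {-1, 1}"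
  shows "\<exists>g' E. (\<forall>p. g' p \<in> {-1, 1}) \<and> finite E \<and> E \<subseteq> {y<..x\<^sup>2 + 1} \<and> card E \<le> x \<and>
           (\<forall>p. p \<notin> E \<longrightarrow> g' p = g p) \<and>
           card (large_prime_set y x) \<le> \<bar>\<Sum>n = 1..x. cm_extension g' (n\<^sup>2 + 1)\<bar>"
proof -
  define A where "A = large_prime_set y x"
  have finA: "finite A" and Ax: "A \<subseteq> {1..x}" by (auto simp: A_def large_prime_set_def)
  have "\<forall>n\<in>A. \<exists>p. prime p \<and> p > y \<and> p dvd n\<^sup>2 + 1" by (auto simp: A_def large_prime_set_def)
  then obtain q where q: "prime (q n)" "q n > y" "q n dvd n\<^sup>2 + 1" if "n \<in> A" for n
    by metis
  have small: "n\<^sup>2 + 1 < p * r" if "n \<in> {1..x}" "p > y" "r > y" for n p r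
  proof -
    have "n\<^sup>2 + 1 \<le> x\<^sup>2 + 1" using that by (intro add_right_mono power_mono) auto
    also have "x\<^sup>2 + 1 < (x + 1) * (x + 1)" using that by (simp add: power2_eq_square)
    also have "\<dots> \<le> p * r" using that y by (intro mult_mono) auto
    finally show ?thesis .
  qed
  have no_two: "\<not> p * r dvd n\<^sup>2 + 1" if "n \<in> {1..x}" "p > y" "r > y" for n p r
  proof
    assume "p * r dvd n\<^sup>2 + 1"
    hence "p * r \<le> n\<^sup>2 + 1" by (rule dvd_imp_le) simp
    thus False using small[OF that] by simp
  qed
  have unique: "r = q n" if "n \<in> A" "prime r" "r > y" "r dvd n\<^sup>2 + 1" for n r
  proof (rule ccontr)
    assume "r \<noteq> q n"
    hence "coprime r (q n)" using that q(1)[OF that(1)] by (simp add: primes_coprime)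
    hence "r * q n dvd n\<^sup>2 + 1" using that q(3)[OF that(1)] by (simp add: divides_mult)
    thus False using no_two[of n r "q n"] that q(2)[OF that(1)] Ax by auto
  qed
  have inj: "inj_on q A"
  proof (rule linorder_inj_onI)
    fix m n assume mn: "m < n" "m \<in> A" "n \<in> A"
    show "q m \<noteq> q n"
    proof
      assume eq: "q m = q n"
      have "q n dvd (n\<^sup>2 + 1) - (m\<^sup>2 + 1)" using q(3)[OF mn(2)] q(3)[OF mn(3)] eq by (intro dvd_diff_nat) auto
      also have "(n\<^sup>2 + 1) - (m\<^sup>2 + 1) = (n - m) * (n + m)"
        using mn(1) by (simp add: algebra_simps power2_eq_square diff_mult_distrib2)
      finally have "q n dvd n - m \<or> q n dvd n + m" using q(1)[OF mn(3)] by (simp add: prime_dvd_mult_iff)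
      hence "q n \<le> n + m" using mn(1) by (auto dest!: dvd_imp_le)
      also have "\<dots> \<le> y" using mn Ax y by (force)
      finally show False using q(2)[OF mn(3)] by simp
    qed
  qed auto
  define S where "S = (\<Sum>n\<in>{1..x} - A. cm_extension g (n\<^sup>2 + 1))"
  define \<sigma> :: real where "\<sigma> = (if S \<ge> 0 then 1 else -1)"
  define g' where "g' p = (if p \<in> q ` A
     then \<sigma> * cm_extension g (((the_inv_into A q p)\<^sup>2 + 1) div p) else g p)" for p
  have signs: "g' p \<in> {-1, 1}" for p
    using cm_extension_sign[of g, OF g] g[of p] by (auto simp: g'_def \<sigma>_def)
  have E: "finite (q ` A)" "card (q ` A) \<le> x"
    using finA card_image_le[OF finA, of q] card_mono[OF _ Ax] by auto
  have sub: "q ` A \<subseteq> {y<..x\<^sup>2 + 1}"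
  proof safe
    fix n assume n: "n \<in> A"
    have "q n \<le> n\<^sup>2 + 1" using q(3)[OF n] by (rule dvd_imp_le) simp
    also have "\<dots> \<le> x\<^sup>2 + 1" using n Ax by (auto intro!: power_mono)
    finally show "q n \<in> {y<..x\<^sup>2 + 1}" using q(2)[OF n] by simp
  qed
  have on: "cm_extension g' (n\<^sup>2 + 1) = \<sigma>" if n: "n \<in> A" for n
  proof -
    define m where "m = (n\<^sup>2 + 1) div q n"
    have eq: "n\<^sup>2 + 1 = q n * m" using q(3)[OF n] by (simp add: m_def)
    hence m: "m > 0" by (intro Nat.gr0I) auto
    have "cm_extension g' m = cm_extension g m"
    proof (rule cm_extension_cong)
      fix r assume r: "prime r" "r dvd m"
      have "r \<notin> q ` A"
      proof
        assume "r \<in> q ` A"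
        hence "r > y" using q(2) by auto
        moreover have "q n * r dvd n\<^sup>2 + 1" using r eq by simp
        ultimately show False using no_two[of n "q n" r] q(2)[OF n] n Ax by auto
      qed
      thus "g' r = g r" by (simp add: g'_def)
    qed
    moreover have "g' (q n) = \<sigma> * cm_extension g m"
      using n by (simp add: g'_def the_inv_into_f_f[OF inj] m_def)
    moreover have "cm_extension g' (n\<^sup>2 + 1) = g' (q n) * cm_extension g' m"
      unfolding eq using m q(1)[OF n] prime_gt_0_nat by (simp add: cm_extension_mult cm_extension_prime)
    ultimately show ?thesis using cm_extension_sign[of g m, OF g] by auto
  qed
  have off: "cm_extension g' (n\<^sup>2 + 1) = cm_extension g (n\<^sup>2 + 1)" if n: "n \<in> {1..x} - A" for n
  proof (rule cm_extension_cong)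
    fix r assume r: "prime r" "r dvd n\<^sup>2 + 1"
    have "r \<notin> q ` A" using n r q(2) by (auto simp: A_def large_prime_set_def)
    thus "g' r = g r" by (simp add: g'_def)
  qed
  have "(\<Sum>n = 1..x. cm_extension g' (n\<^sup>2 + 1)) =
        (\<Sum>n\<in>{1..x} - A. cm_extension g' (n\<^sup>2 + 1)) + (\<Sum>n\<in>A. cm_extension g' (n\<^sup>2 + 1))"
    using Ax by (intro sum.subset_diff) auto
  also have "\<dots> = S + card A * \<sigma>" using on off by (simp add: S_def)
  finally have "card A \<le> \<bar>\<Sum>n = 1..x. cm_extension g' (n\<^sup>2 + 1)\<bar>" by (simp add: \<sigma>_def)
  moreover have "\<forall>p. p \<notin> q ` A \<longrightarrow> g' p = g p" by (simp add: g'_def)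
  ultimately show ?thesis using signs E sub unfolding A_def[symmetric] by blast
qed

text \<open>The scales grow so fast that the primes changed at one scale, which are at most
  \<open>(X k)\<^sup>2 + 1\<close>, lie below all those changed at later scales.\<close>

lemma exists_scales:
  "\<exists>X :: nat \<Rightarrow> nat. \<forall>k. X k \<ge> k + 1 \<and> (X k)\<^sup>2 + 1 < X (Suc k) \<and>
     (1 / 2 - 1 / (real k + 1)) * real (X k) \<le> card (large_prime_set (2 ^ (k + 1) * X k) (X k))"
proof -
  define P where "P k x \<longleftrightarrow> x \<ge> k + 1 \<and>
    (1 / 2 - 1 / (real k + 1)) * real x \<le> card (large_prime_set (2 ^ (k + 1) * x) x)" for k x
  have ev: "eventually (P k) at_top" for k
    unfolding P_def 
    by (intro eventually_conj eventually_ge_at_top eventually_card_large_prime_set) auto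
  have "\<exists>X. \<forall>k. P k (X k) \<and> (X k)\<^sup>2 + 1 < X (Suc k)"
  proof (rule dependent_nat_choice)
    show "\<exists>x. P 0 x" using eventually_happens[OF ev] by simp
    show "\<exists>x'. P (Suc k) x' \<and> x\<^sup>2 + 1 < x'" for x k
      using eventually_happens[OF eventually_conj[OF ev eventually_gt_at_top]] by simp
  qed
  thus ?thesis unfolding P_def by blast
qed

text \<open>Start from the constant \<open>-1\<close> and adjust the signs at one scale after another. At scale \<open>k\<close>
  at most \<open>X k\<close> primes change, all exceeding \<open>2 ^ (k + 1) * X k\<close>, so the sum of their reciprocals is
  at most \<open>1 / 2 ^ (k + 1)\<close> and the total over all scales is finite. Later scales only touch primes
  beyond \<open>(X k)\<^sup>2 + 1\<close>, hence do not affect the sum up to \<open>X k\<close>.\<close>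

lemma exists_adjusted_signs:
  "\<exists>g X. (\<forall>p. g p \<in> {-1, 1::real}) \<and>
     (\<forall>N. (\<Sum>p = 1..N. (1 + g p) / real p) \<le> 2) \<and>
     (\<forall>k. X k \<ge> k + 1 \<and> (1 / 2 - 1 / (real k + 1)) * real (X k) \<le> \<bar>\<Sum>n = 1..X k. cm_extension g (n\<^sup>2 + 1)\<bar>)"
proof -
  obtain X :: "nat \<Rightarrow> nat" where X: "X k \<ge> k + 1" "(X k)\<^sup>2 + 1 < X (Suc k)"
     "(1 / 2 - 1 / (real k + 1)) * real (X k) \<le> card (large_prime_set (2 ^ (k + 1) * X k) (X k))" for k
    using exists_scales by blast
  define y where "y k = 2 ^ (k + 1) * X k" for k
  have Xy: "2 * X k \<le> y k" for k by (simp add: y_def)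
  define Q where "Q k g g' E \<longleftrightarrow> finite E \<and> E \<subseteq> {y k<..(X k)\<^sup>2 + 1} \<and> card E \<le> X k \<and>
           (\<forall>p. p \<notin> E \<longrightarrow> g' p = g p) \<and>
           card (large_prime_set (y k) (X k)) \<le> \<bar>\<Sum>n = 1..X k. cm_extension g' (n\<^sup>2 + 1)\<bar>" for k g g' E
  have "\<exists>G. \<forall>k. ((\<forall>p. G k p \<in> {-1, 1}) \<and> (k = 0 \<longrightarrow> G k = (\<lambda>_. -1))) \<and> (\<exists>E. Q k (G k) (G (Suc k)) E)"
  proof (rule dependent_nat_choice)
    fix g :: "nat \<Rightarrow> real" and k :: nat
    assume "(\<forall>p. g p \<in> {-1, 1}) \<and> (k = 0 \<longrightarrow> g = (\<lambda>_. -1))"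
    thus "\<exists>g'. ((\<forall>p. g' p \<in> {-1, 1}) \<and> (Suc k = 0 \<longrightarrow> g' = (\<lambda>_. -1))) \<and> (\<exists>E. Q k g g' E)"
      using adjust_signs_at_large_primes[OF Xy[of k], of g] unfolding Q_def by auto
  qed auto
  then obtain G where G: "\<And>k p. G k p \<in> {-1, 1}" "G 0 = (\<lambda>_. -1)" "\<forall>k. \<exists>E. Q k (G k) (G (Suc k)) E"
    by blast
  then obtain E where "\<And>k. Q k (G k) (G (Suc k)) (E k)" by metis
  hence E: "finite (E k)" "E k \<subseteq> {y k<..(X k)\<^sup>2 + 1}" "card (E k) \<le> X k"
     "p \<notin> E k \<Longrightarrow> G (Suc k) p = G k p"
     "card (large_prime_set (y k) (X k)) \<le> \<bar>\<Sum>n = 1..X k. cm_extension (G (Suc k)) (n\<^sup>2 + 1)\<bar>" for k p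
    unfolding Q_def by auto
  have "X k \<le> (X k)\<^sup>2" for k by (simp add: power2_eq_square)
  hence "X k \<le> X (Suc k)" for k using X(2)[of k] by (meson add_leD1 le_trans less_imp_le)
  hence X_mono: "X i \<le> X j" if "i \<le> j" for i j using that by (rule lift_Suc_mono_le)
  have stable: "G j p = G i p" if "i \<le> j" "p \<le> X i" for i j p
    using that(1)
  proof (induction j rule: dec_induct)
    case (step j)
    have "p \<le> y j" using X_mono[OF step.hyps(1)] Xy[of j] that(2) by simp
    hence "p \<notin> E j" using E(2)[of j] by auto
    thus ?case using E(4) step.IH by simp
  qed simp
  \<comment> \<open>The sequence \<open>G k p\<close> is constant from \<open>k = p\<close> on because \<open>p < X p\<close>, so this is its limit.\<close>
  define g where "g p = G p p" for p
  have g_eq: "g p = G k p" if "p \<le> X k" for k p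
  proof -
    have "G (max k p) p = G k p" by (rule stable) (use that in auto)
    moreover have "G (max k p) p = G p p" by (rule stable) (use X(1)[of p] in auto)
    ultimately show ?thesis by (simp add: g_def)
  qed
  have sign: "g p \<in> {-1, 1}" for p using G(1) by (simp add: g_def)
  have unchanged: "G k p = -1" if "\<And>j. j < k \<Longrightarrow> p \<notin> E j" for k p
    using that by (induction k) (simp_all add: G(2) E(4))
  have sum_E: "(\<Sum>p\<in>E k. 2 / real p) \<le> (1 / 2) ^ k" for k
  proof -
    have pos: "0 < y k" using X(1)[of k] by (simp add: y_def)
    have "(\<Sum>p\<in>E k. 2 / real p) \<le> (\<Sum>p\<in>E k. 2 / real (y k))"
      using E(2)[of k] pos by (intro sum_mono divide_left_mono) auto
    also have "\<dots> \<le> real (X k) * (2 / real (y k))"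
      unfolding sum_constant using E(3)[of k] by (intro mult_right_mono) auto
    also have "\<dots> = (1 / 2) ^ k"
    proof -
      have "real (y k) = 2 * 2 ^ k * real (X k)" by (simp add: y_def)
      moreover have "real (X k) \<noteq> 0" using X(1)[of k] by simp
      ultimately show ?thesis by (simp add: power_one_over)
    qed
    finally show ?thesis .
  qed
  have recip: "(\<Sum>p = 1..N. (1 + g p) / real p) \<le> 2" for N
  proof -
    have "(\<Sum>p = 1..N. (1 + g p) / real p) \<le> (\<Sum>p = 1..N. \<Sum>k<N. if p \<in> E k then 2 / real p else 0)"
    proof (rule sum_mono)
      fix p assume p: "p \<in> {1..N}"
      show "(1 + g p) / real p \<le> (\<Sum>k<N. if p \<in> E k then 2 / real p else 0)"
      proof (cases "\<exists>k<p. p \<in> E k")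
        case True
        then obtain k where k: "k < p" "p \<in> E k" by blast
        have "(1 + g p) / real p \<le> 2 / real p" using sign[of p] by (intro divide_right_mono) auto
        also have "\<dots> = (if p \<in> E k then 2 / real p else 0)" using k by simp
        also have "\<dots> \<le> (\<Sum>k<N. if p \<in> E k then 2 / real p else 0)"
          using k p by (intro member_le_sum) auto
        finally show ?thesis .
      next
        case False
        hence "g p = -1" using unchanged[of p p] by (auto simp: g_def)
        thus ?thesis by (simp add: sum_nonneg)
      qed
    qed
    also have "\<dots> = (\<Sum>k<N. \<Sum>p = 1..N. if p \<in> E k then 2 / real p else 0)" by (rule sum.swap)
    also have "\<dots> \<le> (\<Sum>k<N. (1 / 2) ^ k)"
    proof (rule sum_mono)
      fix k
      have "(\<Sum>p = 1..N. if p \<in> E k then 2 / real p else 0) = (\<Sum>p\<in>{1..N} \<inter> E k. 2 / real p)"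
        by (simp add: sum.inter_restrict)
      also have "\<dots> \<le> (\<Sum>p\<in>E k. 2 / real p)" using E(1) by (intro sum_mono2) auto
      finally show "(\<Sum>p = 1..N. if p \<in> E k then 2 / real p else 0) \<le> (1 / 2) ^ k" using sum_E[of k] by simp
    qed
    also have "\<dots> \<le> 2" by (simp add: sum_gp_strict)
    finally show ?thesis .
  qed
  have "(1 / 2 - 1 / (real k + 1)) * real (X k) \<le> \<bar>\<Sum>n = 1..X k. cm_extension g (n\<^sup>2 + 1)\<bar>" for k
  proof -
    have "(\<Sum>n = 1..X k. cm_extension g (n\<^sup>2 + 1)) = (\<Sum>n = 1..X k. cm_extension (G (Suc k)) (n\<^sup>2 + 1))"
    proof (intro sum.cong cm_extension_cong refl)
      fix n p assume n: "n \<in> {1..X k}" "p dvd n\<^sup>2 + 1"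
      have "p \<le> n\<^sup>2 + 1" using n(2) by (rule dvd_imp_le) simp
      also have "\<dots> \<le> (X k)\<^sup>2 + 1" using n(1) by (auto intro: power_mono)
      finally show "g p = G (Suc k) p" using X(2)[of k] by (intro g_eq) simp
    qed
    thus ?thesis using X(3)[of k] E(5)[of k] by (simp add: y_def)
  qed
  thus ?thesis using sign recip X(1) by (intro exI[of _ g] exI[of _ X]) auto
qed

theorem proposition1p1:
  shows "\<exists>f :: nat \<Rightarrow> real.
    multiplicative_fun f \<and>
    (\<forall>n>0. f n \<in> {-1..1}) \<and>
    (\<exists>C. \<forall>x::real. x \<ge> 2 \<longrightarrow>
      \<bar>(pretentious_dist (\<lambda>_. 1) (\<lambda>n. complex_of_real (f n)) x)\<^sup>2 - 2 * ln (ln x)\<bar> \<le> C) \<and>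
    Limsup at_top (\<lambda>x::real. ereal \<bar>1 / x * (\<Sum>n | 0 < n \<and> real n \<le> x. f (n\<^sup>2 + 1))\<bar>)
      \<ge> ereal (1 / 2)"
proof -
  obtain g X where g: "\<And>p. g p \<in> {-1, 1}" and recip: "\<And>N. (\<Sum>p = 1..N. (1 + g p) / real p) \<le> 2"
    and X: "\<And>k. X k \<ge> k + 1"
      "\<And>k. (1 / 2 - 1 / (real k + 1)) * real (X k) \<le> \<bar>\<Sum>n = 1..X k. cm_extension g (n\<^sup>2 + 1)\<bar>"
    using exists_adjusted_signs by blast
  define f where "f = cm_extension g"
  obtain C where C: "\<bar>(\<Sum>p = 1..N. if prime p then 1 / real p else 0) - ln (ln (real N))\<bar> \<le> C" if "N \<ge> 2" for N
    using mertens_second by blast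
  have "multiplicative_fun f"
    by (auto simp: multiplicative_fun_def f_def cm_extension_mult) (simp add: cm_extension_def)
  moreover have "f n \<in> {-1..1}" for n
    using cm_extension_sign[of g n] g by (auto simp: f_def)
  moreover have "\<bar>(pretentious_dist (\<lambda>_. 1) (\<lambda>n. complex_of_real (f n)) x)\<^sup>2 - 2 * ln (ln x)\<bar> \<le> 2 * C + 4"
    if x: "x \<ge> 2" for x :: real
  proof -
    define N where "N = nat \<lfloor>x\<rfloor>"
    have le_N: "p \<le> N \<longleftrightarrow> real p \<le> x" for p
      using x by (simp add: N_def le_nat_iff le_floor_iff)
    have "real N = of_int \<lfloor>x\<rfloor>" using x by (simp add: N_def)
    hence N: "real N \<le> x" "x < real N + 1" "N \<ge> 2" using x le_N[of 2] by (linarith, linarith, simp)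
    have fp: "f p = g p" "g p \<le> 1" "0 \<le> 1 + g p" if "prime p" for p
      using that g[of p] by (auto simp: f_def cm_extension_prime)
    have set: "{p. prime p \<and> real p \<le> x} = {p \<in> {1..N}. prime p}"
      by (auto simp: le_N Suc_le_eq prime_gt_0_nat)
    have "(pretentious_dist (\<lambda>_. 1) (\<lambda>n. complex_of_real (f n)) x)\<^sup>2 = (\<Sum>p | prime p \<and> real p \<le> x. (1 - f p) / real p)"
      unfolding pretentious_dist_def by (subst real_sqrt_pow2) (auto intro!: sum_nonneg simp: fp)
    also have "\<dots> = (\<Sum>p = 1..N. if prime p then (1 - g p) / real p else 0)"
      unfolding set by (subst sum.inter_filter) (auto intro!: sum.cong simp: fp)
    also have "\<dots> = (\<Sum>p = 1..N. 2 * (if prime p then 1 / real p else 0) - (if prime p then (1 + g p) / real p else 0))"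
      by (intro sum.cong) (auto simp: field_simps)
    also have "\<dots> = 2 * (\<Sum>p = 1..N. if prime p then 1 / real p else 0) - (\<Sum>p = 1..N. if prime p then (1 + g p) / real p else 0)"
      by (simp add: sum_subtractf sum_distrib_left)
    finally have dist: "(pretentious_dist (\<lambda>_. 1) (\<lambda>n. complex_of_real (f n)) x)\<^sup>2 = \<dots>" .
    have "0 \<le> (\<Sum>p = 1..N. if prime p then (1 + g p) / real p else 0)"
      by (intro sum_nonneg) (auto simp: fp)
    moreover have "(\<Sum>p = 1..N. if prime p then (1 + g p) / real p else 0) \<le> (\<Sum>p = 1..N. (1 + g p) / real p)"
    proof (rule sum_mono)
      fix p show "(if prime p then (1 + g p) / real p else 0) \<le> (1 + g p) / real p"
        using g[of p] by auto
    qed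
    moreover have "\<bar>ln (ln x) - ln (ln N)\<bar> \<le> 1"
    proof -
      have "x \<le> (real N)\<^sup>2"
      proof -
        have "x \<le> 2 * real N" using N by simp
        also have "\<dots> \<le> real N * real N" using N by (intro mult_right_mono) auto
        finally show ?thesis by (simp add: power2_eq_square)
      qed
      hence "ln x \<le> ln ((real N)\<^sup>2)" using x by (intro ln_mono) auto
      also have "\<dots> = 2 * ln (real N)" using N by (simp add: ln_realpow)
      finally have "ln (ln x) \<le> ln (2 * ln (real N))" using x by (intro ln_mono) auto
      also have "\<dots> = ln 2 + ln (ln (real N))" using N by (subst ln_mult) auto
      also have "ln 2 \<le> (1::real)" using ln_le_minus_one[of "2::real"] by simp
      finally have "ln (ln x) \<le> 1 + ln (ln (real N))" by simp
      moreover have "ln (ln (real N)) \<le> ln (ln x)" using N by (intro ln_mono) auto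
      ultimately show ?thesis by linarith
    qed
    ultimately show ?thesis using C[OF N(3)] recip[of N] unfolding dist by linarith
  qed
  moreover have "Limsup at_top (\<lambda>x::real. ereal \<bar>1 / x * (\<Sum>n | 0 < n \<and> real n \<le> x. f (n\<^sup>2 + 1))\<bar>) \<ge> ereal (1 / 2)"
  proof (rule ccontr)
    let ?F = "\<lambda>x::real. \<bar>1 / x * (\<Sum>n | 0 < n \<and> real n \<le> x. f (n\<^sup>2 + 1))\<bar>"
    assume "\<not> Limsup at_top (\<lambda>x. ereal (?F x)) \<ge> ereal (1 / 2)"
    then obtain c where c: "Limsup at_top (\<lambda>x. ereal (?F x)) < ereal c" "c < 1 / 2"
      using ereal_dense2[of "Limsup at_top (\<lambda>x. ereal (?F x))" "ereal (1 / 2)"] by (auto simp: not_le)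
    have "eventually (\<lambda>x. ?F x < c) at_top" using Limsup_lessD[OF c(1)] by simp
    moreover have "filterlim (\<lambda>k. real (X k)) at_top sequentially"
    proof (rule filterlim_at_top_mono[OF filterlim_real_sequentially always_eventually], rule allI)
      fix k show "real k \<le> real (X k)" using X(1)[of k] by simp
    qed
    ultimately have "eventually (\<lambda>k. ?F (real (X k)) < c) sequentially"
      by (rule eventually_compose_filterlim)
    moreover have "eventually (\<lambda>k::nat. c < 1 / 2 - 1 / (real k + 1)) sequentially"
    proof (rule order_tendstoD(1))
      show "(\<lambda>k::nat. 1 / 2 - 1 / (real k + 1)) \<longlonglongrightarrow> 1 / 2" by real_asymp
    qed (rule c(2))
    ultimately have "eventually (\<lambda>k. False) sequentially"
    proof eventually_elim
      case (elim k)
      have pos: "real (X k) > 0" using X(1)[of k] by simp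
      have "{n. 0 < n \<and> real n \<le> real (X k)} = {1..X k}" by auto
      hence "?F (real (X k)) = \<bar>\<Sum>n = 1..X k. cm_extension g (n\<^sup>2 + 1)\<bar> / real (X k)"
        using pos by (simp add: abs_mult f_def)
      also have "\<dots> \<ge> 1 / 2 - 1 / (real k + 1)"
        using X(2)[of k] pos by (simp add: le_divide_eq)
      finally show False using elim by linarith
    qed
    thus False by simp
  qed
  ultimately show ?thesis by blast
qed

end
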